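(* Let $K\in\mathbb R$. If $G=(V,w,m)$ is a graph with $Ric(G)\ge K$, then $G$ is stochastically complete.
   Context: A graph is a triple $G=(V,w,m)$ with $V$ a countable set, $w:V\times V\to[0,\infty)$ symmetric and zero on the diagonal, and $m:V\to(0,\infty)$. Write $x\sim y$ if $w(x,y)>0$. All graphs are locally finite (for each $x$ only finitely many $y$ satisfy $x\sim y$) and connected; $d(x,y)=\inf\{n: x=x_0\sim\cdots\sim x_n=y\}$ is the combinatorial distance, which is finite by connectedness. The Laplacian is $\Delta f(x)=\frac1{m(x)}\sum_{y\in V}w(x,y)(f(y)-f(x))$, and $\mathrm{Deg}(x)=\frac1{m(x)}\sum_{y}w(x,y)$. $Lip(1)$ is the set of $f:V\to\mathbb R$ with $|f(x)-f(y)|\le d(x,y)$ for all $x,y$. Heat semigroup: for non-negative bounded $f:V\to\mathbb R$, $P_tf(x)=u(x,t)$ is the smallest non-negative bounded continuous solution of $\partial_tu=\Delta u$ on $V\times[0,\infty)$, $u(\cdot,0)=f$. $G$ is stochastically complete if $P_t\mathbf 1=\mathbf 1$ for all $t>0$, where $\mathbf 1$ is the constant function $1$. Curvature: for $x\in V$ and $\varepsilon>0$ let $m_x^\varepsilon(x)=1-\varepsilon\,\mathrm{Deg}(x)$ and $m_x^\varepsilon(y)=\varepsilon w(x,y)/m(x)$ for $y\neq x$; this is a finitely supported probability measure for $\varepsilon$ small. For probability measures $\mu,\nu$ on $V$, $W(\mu,\nu)=\sup_{f}\sum_{x}f(x)(\mu(x)-\nu(x))$, the supremum over bounded $f\in Lip(1)$.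 For $x\neq y$ let $\kappa_\varepsilon(x,y)=1-\frac{W(m_x^\varepsilon,m_y^\varepsilon)}{d(x,y)}$ and $\kappa(x,y)=\lim_{\varepsilon\to0^+}\frac1\varepsilon\kappa_\varepsilon(x,y)$ (this limit exists). $Ric(G)\ge K$ means $\kappa(x,y)\ge K$ for all $x\ne y$. *)

theory Defs
  imports "HOL-Analysis.Analysis"
begin

section \<open>Weighted graphs\<close>

text \<open>
  The vertex set is the whole type, of sort countable. All sums over \<open>V\<close> are
  written with \<^const>\<open>infsum\<close> over \<^const>\<open>UNIV\<close>; for the graphs and measures below
  they have only finitely many nonzero terms.
\<close>

definition adj :: "('a \<Rightarrow> 'a \<Rightarrow> real) \<Rightarrow> 'a \<Rightarrow> 'a \<Rightarrow> bool" where
  "adj w x y \<longleftrightarrow> w x y > 0"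

locale weighted_graph =
  fixes w :: "'a::countable \<Rightarrow> 'a \<Rightarrow> real"
    and m :: "'a \<Rightarrow> real"
  assumes weight_nonneg: "w x y \<ge> 0"
    and weight_sym: "w x y = w y x"
    and weight_diag: "w x x = 0"
    and measure_pos: "m x > 0"
    and locally_finite: "finite {y. adj w x y}"
    and connected: "(adj w)\<^sup>*\<^sup>* x y"

text \<open>\<open>(adj w ^^ n) x y\<close> says that there is a walk of length \<open>n\<close> from \<open>x\<close> to \<open>y\<close>.\<close>

definition gdist :: "('a \<Rightarrow> 'a \<Rightarrow> real) \<Rightarrow> 'a \<Rightarrow> 'a \<Rightarrow> nat" where
  "gdist w x y = Inf {n. (adj w ^^ n) x y}"

definition laplacian ::
    "('a \<Rightarrow> 'a \<Rightarrow> real) \<Rightarrow> ('a \<Rightarrow> real) \<Rightarrow> ('a \<Rightarrow> real) \<Rightarrow> 'a \<Rightarrow> real" where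
  "laplacian w m f x = 1 / m x * (\<Sum>\<^sub>\<infinity>y. w x y * (f y - f x))"

definition Deg :: "('a \<Rightarrow> 'a \<Rightarrow> real) \<Rightarrow> ('a \<Rightarrow> real) \<Rightarrow> 'a \<Rightarrow> real" where
  "Deg w m x = 1 / m x * (\<Sum>\<^sub>\<infinity>y. w x y)"

definition Lip1 :: "('a \<Rightarrow> 'a \<Rightarrow> real) \<Rightarrow> ('a \<Rightarrow> real) set" where
  "Lip1 w = {f. \<forall>x y. \<bar>f x - f y\<bar> \<le> real (gdist w x y)}"


section \<open>Heat semigroup and stochastic completeness\<close>

text \<open>
  Non-negative bounded continuous solutions of the heat equation on \<open>V \<times> [0,\<infinity>)\<close> with
  initial value \<open>f\<close>. As \<open>V\<close> is discrete, continuity means continuity in time for each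
  vertex. The time derivative at \<open>0\<close> is one-sided. Values \<open>u x t\<close> with \<open>t < 0\<close>
  are irrelevant.
\<close>

definition heat_solution ::
    "('a \<Rightarrow> 'a \<Rightarrow> real) \<Rightarrow> ('a \<Rightarrow> real) \<Rightarrow> ('a \<Rightarrow> real) \<Rightarrow> ('a \<Rightarrow> real \<Rightarrow> real) \<Rightarrow> bool" where
  "heat_solution w m f u \<longleftrightarrow>
     (\<forall>x. \<forall>t\<ge>0. 0 \<le> u x t) \<and>
     (\<exists>C. \<forall>x. \<forall>t\<ge>0. u x t \<le> C) \<and>
     (\<forall>x. continuous_on {0..} (u x)) \<and>
     (\<forall>x. \<forall>t\<ge>0. (u x has_real_derivative laplacian w m (\<lambda>y. u y t) x) (at t within {0..})) \<and>
     (\<forall>x. u x 0 = f x)"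

definition smallest_heat_solution ::
    "('a \<Rightarrow> 'a \<Rightarrow> real) \<Rightarrow> ('a \<Rightarrow> real) \<Rightarrow> ('a \<Rightarrow> real) \<Rightarrow> ('a \<Rightarrow> real \<Rightarrow> real) \<Rightarrow> bool" where
  "smallest_heat_solution w m f u \<longleftrightarrow>
     heat_solution w m f u \<and>
     (\<forall>v. heat_solution w m f v \<longrightarrow> (\<forall>x. \<forall>t\<ge>0. u x t \<le> v x t))"

text \<open>
  The description ranges over the time slice \<open>u(\<cdot>,t)\<close> rather than over \<open>u\<close>, because
  \<open>u\<close> is only determined for non-negative times. Meaningful for \<open>f\<close> non-negative and
  bounded and \<open>t \<ge> 0\<close>.
\<close>

definition heat_semigroup ::
    "('a \<Rightarrow> 'a \<Rightarrow> real) \<Rightarrow> ('a \<Rightarrow> real) \<Rightarrow> real \<Rightarrow> ('a \<Rightarrow> real) \<Rightarrow> 'a \<Rightarrow> real" where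
  "heat_semigroup w m t f =
     (THE g. \<exists>u. smallest_heat_solution w m f u \<and> g = (\<lambda>x. u x t))"

lemma heat_semigroup_eq:
  assumes u: "smallest_heat_solution w m f u" and t: "t \<ge> 0"
  shows "heat_semigroup w m t f = (\<lambda>x. u x t)"
  unfolding heat_semigroup_def
proof (rule the_equality)
  show "\<exists>v. smallest_heat_solution w m f v \<and> (\<lambda>x. u x t) = (\<lambda>x. v x t)"
    using u by blast
next
  fix g assume "\<exists>v. smallest_heat_solution w m f v \<and> g = (\<lambda>x. v x t)"
  then obtain v where v: "smallest_heat_solution w m f v" and g: "g = (\<lambda>x. v x t)"
    by blast
  have "v x t = u x t" for x
  proof (rule antisym)
    show "v x t \<le> u x t"
      using u v t by (simp add: smallest_heat_solution_def)
    show "u x t \<le> v x t"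
      using u v t by (simp add: smallest_heat_solution_def)
  qed
  then show "g = (\<lambda>x. u x t)"
    using g by simp
qed

definition stochastically_complete ::
    "('a \<Rightarrow> 'a \<Rightarrow> real) \<Rightarrow> ('a \<Rightarrow> real) \<Rightarrow> bool" where
  "stochastically_complete w m \<longleftrightarrow> (\<forall>t>0. heat_semigroup w m t (\<lambda>_. 1) = (\<lambda>_. 1))"


section \<open>Ollivier curvature\<close>

text \<open>Probability measures on \<open>V\<close> are represented by their point masses.\<close>

definition walk_measure ::
    "('a \<Rightarrow> 'a \<Rightarrow> real) \<Rightarrow> ('a \<Rightarrow> real) \<Rightarrow> real \<Rightarrow> 'a \<Rightarrow> 'a \<Rightarrow> real" where
  "walk_measure w m \<epsilon> x y = (if y = x then 1 - \<epsilon> * Deg w m x else \<epsilon> * w x y / m x)"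

definition wasserstein ::
    "('a \<Rightarrow> 'a \<Rightarrow> real) \<Rightarrow> ('a \<Rightarrow> real) \<Rightarrow> ('a \<Rightarrow> real) \<Rightarrow> real" where
  "wasserstein w \<mu> \<nu> =
     (SUP f \<in> {f \<in> Lip1 w. bounded (range f)}. \<Sum>\<^sub>\<infinity>x. f x * (\<mu> x - \<nu> x))"

definition curvature_eps ::
    "('a \<Rightarrow> 'a \<Rightarrow> real) \<Rightarrow> ('a \<Rightarrow> real) \<Rightarrow> real \<Rightarrow> 'a \<Rightarrow> 'a \<Rightarrow> real" where
  "curvature_eps w m \<epsilon> x y =
     1 - wasserstein w (walk_measure w m \<epsilon> x) (walk_measure w m \<epsilon> y) / real (gdist w x y)"

definition curvature ::
    "('a \<Rightarrow> 'a \<Rightarrow> real) \<Rightarrow> ('a \<Rightarrow> real) \<Rightarrow> 'a \<Rightarrow> 'a \<Rightarrow> real" where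
  "curvature w m x y = Lim (at_right 0) (\<lambda>\<epsilon>. 1 / \<epsilon> * curvature_eps w m \<epsilon> x y)"

definition Ric_ge :: "('a \<Rightarrow> 'a \<Rightarrow> real) \<Rightarrow> ('a \<Rightarrow> real) \<Rightarrow> real \<Rightarrow> bool" where
  "Ric_ge w m K \<longleftrightarrow> (\<forall>x y. x \<noteq> y \<longrightarrow> curvature w m x y \<ge> K)"

end

theory Submission
  imports Defs
begin

text \<open>
  Testing the Wasserstein distance between the walk measures at \<open>x\<close> and \<open>x\<^sub>0\<close> with a
  truncation of the distance \<open>d(x\<^sub>0, \<cdot>)\<close> turns the curvature bound into the Laplacian
  comparison \<open>\<Delta> d(x\<^sub>0, \<cdot>)(x) \<le> Deg x\<^sub>0 - K d(x\<^sub>0, x)\<close>. Hence \<open>h = d(x\<^sub>0, \<cdot>) + 1\<close> is a positive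
  function with finite sublevel sets and \<open>\<Delta> h \<le> c h\<close>, as in Khasminskii's criterion: the
  maximum principle applied to \<open>1 - u - \<delta> e\<^bsup>(c+1)t\<^esup> h\<close> for \<open>\<delta> \<rightarrow> 0\<close> shows that every
  non-negative solution \<open>u\<close> with initial value \<open>1\<close> is at least \<open>1\<close>, so the constant \<open>1\<close> is the
  smallest one.
\<close>

context weighted_graph
begin

section \<open>Combinatorial distance and finiteness of balls\<close>

lemma adj_sym: "adj w x y \<Longrightarrow> adj w y x"
  by (simp add: adj_def weight_sym)

lemma not_adj_weight: "\<not> adj w x y \<Longrightarrow> w x y = 0"
  using weight_nonneg[of x y] by (simp add: adj_def)

lemma adj_imp_neq: "adj w x y \<Longrightarrow> x \<noteq> y"
  by (auto simp: adj_def weight_diag)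

text \<open>Connectedness makes the set of walk lengths nonempty, so its infimum is an attained
  minimum and not a default value.\<close>

lemma walk_gdist: "(adj w ^^ gdist w x y) x y"
proof -
  have "{n. (adj w ^^ n) x y} \<noteq> {}"
    using rtranclp_imp_relpowp[OF connected[of x y]] by auto
  from Inf_nat_def1[OF this] show ?thesis
    by (simp add: gdist_def)
qed

lemma gdist_le: "(adj w ^^ n) x y \<Longrightarrow> gdist w x y \<le> n"
  unfolding gdist_def by (rule cInf_lower) auto

lemma gdist_refl [simp]: "gdist w x x = 0"
  using gdist_le[of 0 x x] by simp

lemma gdist_eq_0_iff [simp]: "gdist w x y = 0 \<longleftrightarrow> x = y"
  using walk_gdist[of x y] by auto

lemma gdist_triangle: "gdist w x z \<le> gdist w x y + gdist w y z"
proof (rule gdist_le)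
  show "(adj w ^^ (gdist w x y + gdist w y z)) x z"
    unfolding relpowp_add using walk_gdist by blast
qed

lemma walk_sym: "(adj w ^^ n) x y \<Longrightarrow> (adj w ^^ n) y x"
proof (induction n arbitrary: y)
  case (Suc n)
  then obtain z where "(adj w ^^ n) x z" "adj w z y" by auto
  then show ?case
    using Suc.IH by (blast intro: relpowp_Suc_I2 adj_sym)
qed simp

lemma gdist_sym: "gdist w x y = gdist w y x"
  using gdist_le walk_sym walk_gdist by (meson le_antisym)

lemma gdist_adj: "adj w x y \<Longrightarrow> gdist w x y = 1"
  using gdist_le[of 1 x y] gdist_eq_0_iff[of x y] adj_imp_neq[of x y]
  by (auto simp: le_Suc_eq relpowp_1 simp del: gdist_eq_0_iff)

lemma finite_walk_targets: "finite {y. (adj w ^^ n) x y}"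
proof (induction n)
  case (Suc n)
  have "{y. (adj w ^^ Suc n) x y} = (\<Union>z\<in>{z. (adj w ^^ n) x z}. {y. adj w z y})"
    by auto
  then show ?case
    using Suc locally_finite by simp
qed simp

text \<open>Local finiteness enters the argument here: it later gives the finite sublevel sets of
  \<open>h\<close>.\<close>

lemma finite_gdist_ball: "finite {y. gdist w x y \<le> n}"
proof (rule finite_subset)
  show "{y. gdist w x y \<le> n} \<subseteq> (\<Union>k\<le>n. {y. (adj w ^^ k) x y})"
    using walk_gdist by auto
qed (simp add: finite_walk_targets)

section \<open>The Laplacian as a finite sum\<close>

lemma laplacian_eq_sum:
  "laplacian w m f x = (\<Sum>y | adj w x y. w x y * (f y - f x)) / m x"
proof -
  have "(\<Sum>\<^sub>\<infinity>y. w x y * (f y - f x)) = (\<Sum>\<^sub>\<infinity>y\<in>{y. adj w x y}. w x y * (f y - f x))"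
    by (rule infsum_cong_neutral) (auto simp: not_adj_weight)
  then show ?thesis
    by (simp add: laplacian_def locally_finite)
qed

lemma Deg_eq_sum: "Deg w m x = (\<Sum>y | adj w x y. w x y) / m x"
proof -
  have "(\<Sum>\<^sub>\<infinity>y. w x y) = (\<Sum>\<^sub>\<infinity>y\<in>{y. adj w x y}. w x y)"
    by (rule infsum_cong_neutral) (auto simp: not_adj_weight)
  then show ?thesis
    by (simp add: Deg_def locally_finite)
qed

lemma Deg_nonneg: "Deg w m x \<ge> 0"
  unfolding Deg_eq_sum using measure_pos[of x] weight_nonneg
  by (auto intro!: divide_nonneg_pos sum_nonneg)

text \<open>Only increments along edges at \<open>x\<close> enter the Laplacian. Phrased with
  increments, the lemma also yields the sign of the Laplacian at a maximum, by taking
  \<open>g\<close> constant.\<close>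

lemma laplacian_mono:
  assumes "\<And>y. adj w x y \<Longrightarrow> f y - f x \<le> g y - g x"
  shows "laplacian w m f x \<le> laplacian w m g x"
  unfolding laplacian_eq_sum using assms weight_nonneg measure_pos[of x]
  by (auto intro!: divide_right_mono sum_mono mult_left_mono simp: less_imp_le)

lemma laplacian_cong:
  assumes "\<And>y. adj w x y \<Longrightarrow> f y - f x = g y - g x"
  shows "laplacian w m f x = laplacian w m g x"
  using assms by (intro antisym laplacian_mono) auto

lemma laplacian_linear:
  "laplacian w m (\<lambda>y. a * f y + b * g y) x = a * laplacian w m f x + b * laplacian w m g x"
proof -
  have "w x y * ((a * f y + b * g y) - (a * f x + b * g x))
      = a * (w x y * (f y - f x)) + b * (w x y * (g y - g x))" for y
    by (simp add: algebra_simps)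
  then show ?thesis
    unfolding laplacian_eq_sum
    by (simp add: sum.distrib sum_distrib_left[symmetric] add_divide_distrib)
qed

lemma laplacian_const [simp]: "laplacian w m (\<lambda>_. c) x = 0"
  by (simp add: laplacian_eq_sum)

lemma laplacian_eq_Deg:
  assumes "\<And>y. adj w x y \<Longrightarrow> f y - f x = c"
  shows "laplacian w m f x = c * Deg w m x"
  unfolding laplacian_eq_sum Deg_eq_sum using assms
  by (simp add: sum_distrib_right[symmetric])

section \<open>Test functions, walk measures and the Wasserstein distance\<close>

lemma Lip1D: "f \<in> Lip1 w \<Longrightarrow> \<bar>f x - f y\<bar> \<le> gdist w x y"
  by (simp add: Lip1_def)

text \<open>This bound is uniform in the test function, which keeps the Wasserstein supremum
  finite.\<close>

lemma abs_laplacian_Lip1_le: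
  assumes "f \<in> Lip1 w"
  shows "\<bar>laplacian w m f x\<bar> \<le> Deg w m x"
proof -
  have "\<bar>f y - f x\<bar> \<le> 1" if "adj w x y" for y
    using Lip1D[OF assms, of y x] gdist_adj[OF adj_sym[OF that]] by simp
  then have "\<bar>w x y * (f y - f x)\<bar> \<le> w x y" if "adj w x y" for y
    using that weight_nonneg[of x y] by (simp add: abs_mult mult_left_le)
  then have "\<bar>\<Sum>y | adj w x y. w x y * (f y - f x)\<bar> \<le> (\<Sum>y | adj w x y. w x y)"
    by (intro order.trans[OF sum_abs] sum_mono) auto
  then show ?thesis
    unfolding laplacian_eq_sum Deg_eq_sum using measure_pos[of x]
    by (simp add: divide_right_mono abs_divide)
qed

text \<open>Averaging over the walk measure is one explicit Euler step of the heat equation. The set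
  \<open>S\<close> may exceed the support, so that two walk measures can be summed over a common
  set.\<close>

lemma sum_walk_measure:
  assumes "finite S" "insert x {y. adj w x y} \<subseteq> S"
  shows "(\<Sum>z\<in>S. f z * walk_measure w m \<epsilon> x z) = f x + \<epsilon> * laplacian w m f x"
proof -
  have nx: "x \<notin> {y. adj w x y}"
    using adj_imp_neq by blast
  have "(\<Sum>z\<in>S. f z * walk_measure w m \<epsilon> x z)
      = (\<Sum>z\<in>insert x {y. adj w x y}. f z * walk_measure w m \<epsilon> x z)"
    using assms by (intro sum.mono_neutral_right) (auto simp: walk_measure_def not_adj_weight)
  also have "\<dots> = f x * (1 - \<epsilon> * Deg w m x)
      + (\<Sum>z | adj w x z. f z * walk_measure w m \<epsilon> x z)"
    using nx locally_finite by (simp add: walk_measure_def)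
  also have "(\<Sum>z | adj w x z. f z * walk_measure w m \<epsilon> x z)
      = (\<Sum>z | adj w x z. \<epsilon> * (w x z * f z) / m x)"
    using nx by (intro sum.cong) (auto simp: walk_measure_def)
  also have "f x * (1 - \<epsilon> * Deg w m x) + \<dots> = f x + \<epsilon> * laplacian w m f x"
    by (simp add: laplacian_eq_sum Deg_eq_sum sum_distrib_left sum_subtractf algebra_simps
        sum_divide_distrib diff_divide_distrib)
  finally show ?thesis .
qed

lemma infsum_walk_measure_diff:
  "(\<Sum>\<^sub>\<infinity>z. f z * (walk_measure w m \<epsilon> x z - walk_measure w m \<epsilon> y z))
    = (f x - f y) + \<epsilon> * (laplacian w m f x - laplacian w m f y)"
proof -
  define S where "S = insert x {z. adj w x z} \<union> insert y {z. adj w y z}"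
  have fin: "finite S"
    by (simp add: S_def locally_finite)
  have "(\<Sum>\<^sub>\<infinity>z. f z * (walk_measure w m \<epsilon> x z - walk_measure w m \<epsilon> y z))
      = (\<Sum>\<^sub>\<infinity>z\<in>S. f z * (walk_measure w m \<epsilon> x z - walk_measure w m \<epsilon> y z))"
    by (rule infsum_cong_neutral) (auto simp: S_def walk_measure_def not_adj_weight)
  also have "\<dots> = (\<Sum>z\<in>S. f z * walk_measure w m \<epsilon> x z) - (\<Sum>z\<in>S. f z * walk_measure w m \<epsilon> y z)"
    using fin by (simp add: sum_subtractf right_diff_distrib)
  also have "\<dots> = (f x + \<epsilon> * laplacian w m f x) - (f y + \<epsilon> * laplacian w m f y)"
    using fin by (subst (1 2) sum_walk_measure) (auto simp: S_def)
  finally show ?thesis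
    by (simp add: algebra_simps)
qed

lemma wasserstein_walk_measure:
  "wasserstein w (walk_measure w m \<epsilon> x) (walk_measure w m \<epsilon> y)
    = (SUP f \<in> {f \<in> Lip1 w. bounded (range f)}.
        (f x - f y) + \<epsilon> * (laplacian w m f x - laplacian w m f y))"
  by (simp add: wasserstein_def infsum_walk_measure_diff)

lemma bdd_above_walk_wasserstein:
  "bdd_above ((\<lambda>f. (f x - f y) + \<epsilon> * (laplacian w m f x - laplacian w m f y))
    ` {f \<in> Lip1 w. bounded (range f)})"
proof (rule bdd_aboveI2)
  fix f assume "f \<in> {f \<in> Lip1 w. bounded (range f)}"
  then have f: "f \<in> Lip1 w" by simp
  have "\<epsilon> * (laplacian w m f x - laplacian w m f y)
      \<le> \<bar>\<epsilon>\<bar> * \<bar>laplacian w m f x - laplacian w m f y\<bar>"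
    by (metis abs_ge_self abs_mult)
  also have "\<dots> \<le> \<bar>\<epsilon>\<bar> * (Deg w m x + Deg w m y)"
    using abs_laplacian_Lip1_le[OF f, of x] abs_laplacian_Lip1_le[OF f, of y]
    by (intro mult_left_mono) auto
  moreover have "f x - f y \<le> gdist w x y"
    using f Lip1D[of f x y] by linarith
  ultimately show "(f x - f y) + \<epsilon> * (laplacian w m f x - laplacian w m f y)
      \<le> gdist w x y + \<bar>\<epsilon>\<bar> * (Deg w m x + Deg w m y)"
    by linarith
qed

section \<open>Curvature and its limit\<close>

text \<open>Each test function bounds the supremum \<open>W\<close> from below, hence the curvature
  from above. The right side separates the part depending on \<open>\<epsilon>\<close> from a
  constant.\<close>

lemma curvature_eps_le:
  assumes "f \<in> Lip1 w" "bounded (range f)" "x \<noteq> y" "\<epsilon> > 0"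
  shows "1 / \<epsilon> * curvature_eps w m \<epsilon> x y
    \<le> (1 - (f x - f y) / gdist w x y) / \<epsilon>
      - (laplacian w m f x - laplacian w m f y) / gdist w x y"
proof -
  have d: "real (gdist w x y) > 0"
    using assms by (simp add: zero_less_iff_neq_zero)
  have "(f x - f y) + \<epsilon> * (laplacian w m f x - laplacian w m f y)
      \<le> wasserstein w (walk_measure w m \<epsilon> x) (walk_measure w m \<epsilon> y)"
    unfolding wasserstein_walk_measure
    using assms by (intro cSUP_upper bdd_above_walk_wasserstein) auto
  then have "1 / \<epsilon> * curvature_eps w m \<epsilon> x y
      \<le> 1 / \<epsilon> * (1 - ((f x - f y) + \<epsilon> * (laplacian w m f x - laplacian w m f y)) / gdist w x y)"
    unfolding curvature_eps_def using assms d
    by (intro mult_left_mono diff_left_mono divide_right_mono) auto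
  also have "\<dots> = (1 - (f x - f y) / gdist w x y) / \<epsilon>
      - (laplacian w m f x - laplacian w m f y) / gdist w x y"
    using assms d by (simp add: field_simps)
  finally show ?thesis .
qed

text \<open>
  Each \<open>f\<close> in the supremum defining \<open>W\<close> contributes \<open>(1 - (f x - f y) / d) / \<epsilon>\<close> plus a constant
  to the infimum defining \<open>\<kappa>\<^sub>\<epsilon> / \<epsilon>\<close>, and the numerator is non-negative as \<open>f\<close> is 1-Lipschitz.
  Monotonicity makes the limit defining \<open>\<kappa>\<close> exist; otherwise \<^const>\<open>Lim\<close> is unspecified.
\<close>

lemma curvature_eps_antimono:
  assumes "x \<noteq> y" "0 < \<epsilon>" "\<epsilon> \<le> \<eta>"
  shows "1 / \<eta> * curvature_eps w m \<eta> x y \<le> 1 / \<epsilon> * curvature_eps w m \<epsilon> x y"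
proof -
  define k where "k = 1 / \<eta> * curvature_eps w m \<eta> x y"
  have d: "real (gdist w x y) > 0"
    using assms by (simp add: zero_less_iff_neq_zero)
  \<comment> \<open>The claim amounts to an upper bound on \<open>W\<close> at
    \<open>\<epsilon>\<close>, which can be checked for one test function at a time.\<close>
  have "wasserstein w (walk_measure w m \<epsilon> x) (walk_measure w m \<epsilon> y)
      \<le> (1 - \<epsilon> * k) * gdist w x y"
    unfolding wasserstein_walk_measure
  proof (rule cSUP_least)
    have "(\<lambda>_. 0) \<in> {f \<in> Lip1 w. bounded (range f)}"
      by (simp add: Lip1_def)
    then show "{f \<in> Lip1 w. bounded (range f)} \<noteq> {}" by blast
  next
    fix f assume "f \<in> {f \<in> Lip1 w. bounded (range f)}"
    then have f: "f \<in> Lip1 w" "bounded (range f)" by auto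
    define q where "q = (laplacian w m f x - laplacian w m f y) / gdist w x y"
    have "f x - f y \<le> gdist w x y"
      using f Lip1D[of f x y] by linarith
    then have "0 \<le> 1 - (f x - f y) / gdist w x y"
      using d by simp
    then have "(1 - (f x - f y) / gdist w x y) / \<eta> \<le> (1 - (f x - f y) / gdist w x y) / \<epsilon>"
      using assms by (intro divide_left_mono) auto
    moreover have "k \<le> (1 - (f x - f y) / gdist w x y) / \<eta> - q"
      unfolding k_def q_def using assms f by (intro curvature_eps_le) auto
    ultimately have "k \<le> (1 - (f x - f y) / gdist w x y) / \<epsilon> - q"
      by linarith
    then have "\<epsilon> * k \<le> \<epsilon> * ((1 - (f x - f y) / gdist w x y) / \<epsilon> - q)"
      using assms by (intro mult_left_mono) auto
    also have "\<dots> = 1 - (f x - f y) / gdist w x y - \<epsilon> * q"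
      using assms by (subst right_diff_distrib) simp
    finally have "(f x - f y) / gdist w x y + \<epsilon> * q \<le> 1 - \<epsilon> * k"
      by linarith
    then have "((f x - f y) / gdist w x y + \<epsilon> * q) * gdist w x y \<le> (1 - \<epsilon> * k) * gdist w x y"
      by (intro mult_right_mono) auto
    then show "(f x - f y) + \<epsilon> * (laplacian w m f x - laplacian w m f y)
        \<le> (1 - \<epsilon> * k) * gdist w x y"
      using d \<open>x \<noteq> y\<close> by (simp add: q_def distrib_right)
  qed
  then have "wasserstein w (walk_measure w m \<epsilon> x) (walk_measure w m \<epsilon> y) / gdist w x y
      \<le> 1 - \<epsilon> * k"
    using d by (simp add: pos_divide_le_eq)
  then have "\<epsilon> * k \<le> curvature_eps w m \<epsilon> x y"
    by (simp add: curvature_eps_def)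
  then show ?thesis
    unfolding k_def[symmetric] using assms by (simp add: pos_le_divide_eq mult.commute)
qed

text \<open>For a test function that attains the distance, the term divided by
  \<open>\<epsilon>\<close> vanishes, so the bound on the quotient is uniform in
  \<open>\<epsilon>\<close>. The quotient grows as \<open>\<epsilon>\<close> decreases and therefore
  converges to its supremum.\<close>

lemma curvature_le:
  assumes f: "f \<in> Lip1 w" "bounded (range f)" and "x \<noteq> y" and fxy: "f x - f y = gdist w x y"
  shows "curvature w m x y \<le> (laplacian w m f y - laplacian w m f x) / gdist w x y"
proof -
  define k where "k \<epsilon> = 1 / \<epsilon> * curvature_eps w m \<epsilon> x y" for \<epsilon>
  define B where "B = (laplacian w m f y - laplacian w m f x) / gdist w x y"
  have le: "k \<epsilon> \<le> B" if "\<epsilon> > 0" for \<epsilon>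
    using curvature_eps_le[OF f \<open>x \<noteq> y\<close> that] fxy \<open>x \<noteq> y\<close>
    by (simp add: k_def B_def diff_divide_distrib)
  define L where "L = (SUP \<epsilon>\<in>{0<..}. k \<epsilon>)"
  have bdd: "bdd_above (k ` {0<..})"
    using le by (intro bdd_aboveI2) auto
  have "(k \<longlongrightarrow> L) (at_right 0)"
  proof (rule order_tendstoI)
    \<comment> \<open>Some \<open>\<eta>\<close> already pushes the quotient above \<open>a\<close>;
      by monotonicity so does every smaller \<open>\<epsilon>\<close>.\<close>
    fix a assume "a < L"
    then obtain \<eta> where \<eta>: "\<eta> > 0" "a < k \<eta>"
      unfolding L_def by (subst (asm) less_cSUP_iff) (use bdd in auto)
    have "\<forall>\<^sub>F \<epsilon> in at_right 0. \<epsilon> \<in> {0<..<\<eta>}"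
      using \<eta> by (intro eventually_at_right_real)
    then show "\<forall>\<^sub>F \<epsilon> in at_right 0. a < k \<epsilon>"
    proof eventually_elim
      case (elim \<epsilon>)
      then have "k \<eta> \<le> k \<epsilon>"
        unfolding k_def using \<open>x \<noteq> y\<close> by (intro curvature_eps_antimono) auto
      with \<eta> show ?case by simp
    qed
  next
    fix a assume a: "L < a"
    have "\<forall>\<^sub>F \<epsilon> in at_right 0. \<epsilon> \<in> {0<..<1::real}"
      by (intro eventually_at_right_real) simp
    then show "\<forall>\<^sub>F \<epsilon> in at_right 0. k \<epsilon> < a"
    proof eventually_elim
      case (elim \<epsilon>)
      then have "k \<epsilon> \<le> L"
        unfolding L_def by (intro cSUP_upper bdd) auto
      with a show ?case by simp
    qed
  qed
  then have "curvature w m x y = L"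
    unfolding curvature_def k_def by (intro tendsto_Lim) auto
  also have "L \<le> B"
    unfolding L_def using le by (intro cSUP_least) auto
  finally show ?thesis by (simp add: B_def)
qed

section \<open>Laplacian comparison for the distance function\<close>

lemma truncated_gdist_Lip1: "(\<lambda>z. min (real (gdist w y z)) r) \<in> Lip1 w"
  unfolding Lip1_def
proof (intro CollectI allI)
  fix a b
  show "\<bar>min (real (gdist w y a)) r - min (real (gdist w y b)) r\<bar> \<le> gdist w a b"
    using gdist_triangle[of y a b] gdist_triangle[of y b a] gdist_sym[of a b] by linarith
qed

lemma laplacian_comparison:
  assumes "Ric_ge w m K"
  shows "laplacian w m (\<lambda>z. real (gdist w y z)) x \<le> Deg w m y - K * gdist w y x"
proof (cases "x = y")
  case True
  \<comment> \<open>At the base point every neighbour is at distance 1, so equality holds and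
    curvature is not involved.\<close>
  then show ?thesis
    by (simp add: laplacian_eq_Deg[where c = 1] gdist_adj)
next
  case False
  \<comment> \<open>The supremum in \<open>W\<close> admits only bounded functions. Truncating one
    above the distance of \<open>x\<close> changes the value at no neighbour of \<open>x\<close> or
    \<open>y\<close>, so both Laplacians survive.\<close>
  define f where "f z = min (real (gdist w y z)) (gdist w y x + 1)" for z
  have d: "real (gdist w y x) > 0"
    using False by (simp add: zero_less_iff_neq_zero)
  have "\<bar>f z\<bar> \<le> gdist w y x + 1" for z
    by (simp add: f_def)
  then have bdd: "bounded (range f)"
    by (auto simp: bounded_iff)
  have lip: "f \<in> Lip1 w"
    unfolding f_def by (rule truncated_gdist_Lip1)
  have "K \<le> curvature w m x y"
    using assms False by (simp add: Ric_ge_def)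
  also have "\<dots> \<le> (laplacian w m f y - laplacian w m f x) / gdist w x y"
    using lip bdd False by (intro curvature_le) (auto simp: f_def gdist_sym)
  also have "laplacian w m f y = Deg w m y"
    using d by (subst laplacian_eq_Deg[where c = 1]) (auto simp: f_def gdist_adj)
  also have "laplacian w m f x = laplacian w m (\<lambda>z. real (gdist w y z)) x"
  proof (rule laplacian_cong)
    fix z assume "adj w x z"
    then have "gdist w y z \<le> gdist w y x + 1"
      using gdist_triangle[of y z x] gdist_adj[of x z] by simp
    then show "f z - f x = real (gdist w y z) - real (gdist w y x)"
      by (simp add: f_def)
  qed
  finally show ?thesis
    using d by (simp add: gdist_sym[of x y] field_simps)
qed

section \<open>Parabolic maximum principle\<close>

text \<open>A positive value would yield a positive space-time maximum, attained in the finite set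
  \<open>B\<close>. The Laplacian is at most 0 there, so the time derivative is strictly negative
  and \<open>p\<close> was larger just before.\<close>

lemma subsolution_maximum:
  assumes T: "T \<ge> 0" and fin: "finite B"
    and off: "\<And>x t. x \<notin> B \<Longrightarrow> 0 \<le> t \<Longrightarrow> t \<le> T \<Longrightarrow> p x t \<le> 0"
    and deriv: "\<And>x t. 0 \<le> t \<Longrightarrow> t \<le> T \<Longrightarrow> (p x has_real_derivative p' x t) (at t within {0..})"
    and sub: "\<And>x t. 0 \<le> t \<Longrightarrow> t \<le> T \<Longrightarrow> p x t > 0 \<Longrightarrow> p' x t < laplacian w m (\<lambda>y. p y t) x"
    and init: "\<And>x. p x 0 \<le> 0"
    and "0 \<le> t" "t \<le> T"
  shows "p x t \<le> 0"
proof (rule ccontr)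
  assume pos: "\<not> p x t \<le> 0"
  \<comment> \<open>First each vertex is maximised over time, by compactness; then the finitely many
    vertices of \<open>B\<close> are compared.\<close>
  have "\<exists>s\<in>{0..T}. \<forall>r\<in>{0..T}. p y r \<le> p y s" for y
  proof (rule continuous_attains_sup)
    show "continuous_on {0..T} (p y)"
      unfolding continuous_on_eq_continuous_within
      using deriv by (fastforce intro: DERIV_continuous DERIV_subset)
  qed (use T in auto)
  then obtain s where s: "\<And>y. s y \<in> {0..T}" "\<And>y r. r \<in> {0..T} \<Longrightarrow> p y r \<le> p y (s y)"
    by metis
  have "x \<in> B"
    using pos off assms by blast
  then have "Max ((\<lambda>y. p y (s y)) ` B) \<in> (\<lambda>y. p y (s y)) ` B"
    using fin by (intro Max_in) auto
  then obtain z where z: "z \<in> B" "Max ((\<lambda>y. p y (s y)) ` B) = p z (s z)"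
    by auto
  have max: "p y r \<le> p z (s z)" if "y \<in> B" "r \<in> {0..T}" for y r
  proof -
    have "p y (s y) \<le> Max ((\<lambda>y. p y (s y)) ` B)"
      using that fin by (intro Max_ge) auto
    with s(2)[OF that(2)] z show ?thesis by (metis order.trans)
  qed
  have pz: "p z (s z) > 0"
    using max[OF \<open>x \<in> B\<close>, of t] pos assms by auto
  \<comment> \<open>The initial condition excludes time 0, so there is an earlier time to compare
    with.\<close>
  have sz: "0 < s z" "s z \<le> T"
    using s(1)[of z] pz init[of z] by (auto simp: less_le)
  have "p y (s z) \<le> p z (s z)" for y
    using max[of y "s z"] off[of y "s z"] sz pz by (cases "y \<in> B") auto
  then have "laplacian w m (\<lambda>y. p y (s z)) z \<le> laplacian w m (\<lambda>_. 0) z"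
    by (intro laplacian_mono) auto
  then have neg: "p' z (s z) < 0"
    using sub[of "s z" z] pz sz by simp
  have "(p z has_real_derivative p' z (s z)) (at (s z) within {0..})"
    using sz by (intro deriv) auto
  from has_real_derivative_neg_dec_left[OF this neg] obtain e where e: "e > 0"
    "\<And>h. 0 < h \<Longrightarrow> s z - h \<in> {0..} \<Longrightarrow> h < e \<Longrightarrow> p z (s z) < p z (s z - h)"
    by blast
  define h where "h = min (e / 2) (s z)"
  have "0 < h" "h < e" "h \<le> s z"
    using e sz by (auto simp: h_def)
  then show False
    using e(2)[of h] max[OF z(1), of "s z - h"] sz by auto
qed

text \<open>The barrier exceeds the bound \<open>C\<close> outside a finite sublevel set of
  \<open>h\<close>, which stands in for compactness of the vertex set.\<close>

lemma bounded_solution_nonpos: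
  assumes h_pos: "\<And>x. h x > 0" and h_fin: "\<And>r. finite {x. h x \<le> r}"
    and h_lap: "\<And>x. laplacian w m h x \<le> c * h x" and "c \<ge> 0"
    and deriv: "\<And>x t. t \<ge> 0 \<Longrightarrow>
      (g x has_real_derivative laplacian w m (\<lambda>y. g y t) x) (at t within {0..})"
    and init: "\<And>x. g x 0 \<le> 0" and bound: "\<And>x t. t \<ge> 0 \<Longrightarrow> g x t \<le> C"
    and "t \<ge> 0"
  shows "g x t \<le> 0"
proof -
  have approx: "g x t \<le> \<delta> * (exp ((c + 1) * t) * h x)" if "\<delta> > 0" for \<delta>
  proof -
    define p where "p x t = g x t - \<delta> * (exp ((c + 1) * t) * h x)" for x t
    define p' where "p' x t = laplacian w m (\<lambda>y. g y t) x
      - \<delta> * ((c + 1) * exp ((c + 1) * t) * h x)" for x t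
    have "p x t \<le> 0"
    proof (rule subsolution_maximum[where p = p and p' = p' and T = t and B = "{x. h x \<le> C / \<delta>}"])
      fix x and s :: real
      assume "x \<notin> {x. h x \<le> C / \<delta>}" and s: "0 \<le> s"
      then have "C \<le> \<delta> * h x"
        using that by (simp add: field_simps)
      also have "\<dots> \<le> \<delta> * (exp ((c + 1) * s) * h x)"
        using that h_pos[of x] s \<open>c \<ge> 0\<close> by (intro mult_left_mono) auto
      finally show "p x s \<le> 0"
        using bound[OF s, of x] by (simp add: p_def)
    next
      fix x s assume "0 \<le> (s::real)"
      then show "(p x has_real_derivative p' x s) (at s within {0..})"
        unfolding p_def p'_def
        by (auto intro!: derivative_eq_intros deriv)
    next
      fix x and s :: real
      define E where "E = \<delta> * exp ((c + 1) * s)"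
      have E: "E > 0" using that by (simp add: E_def)
      have "laplacian w m (\<lambda>y. p y s) x
          = laplacian w m (\<lambda>y. 1 * g y s + (- E) * h y) x"
        by (simp add: p_def E_def mult.assoc)
      also have "\<dots> = laplacian w m (\<lambda>y. g y s) x - E * laplacian w m h x"
        by (subst laplacian_linear) simp
      also have "\<dots> \<ge> laplacian w m (\<lambda>y. g y s) x - E * (c * h x)"
        using E h_lap[of x] by simp
      \<comment> \<open>The rate \<open>c + 1\<close> in place of \<open>c\<close> leaves the gap
        \<open>E * h x\<close>, which supplies the strict inequality.\<close>
      moreover have "E * (c * h x) < E * ((c + 1) * h x)"
        using E h_pos[of x] by simp
      moreover have "p' x s = laplacian w m (\<lambda>y. g y s) x - E * ((c + 1) * h x)"
        by (simp add: p'_def E_def mult_ac)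
      ultimately show "p' x s < laplacian w m (\<lambda>y. p y s) x"
        by linarith
    next
      fix x show "p x 0 \<le> 0"
        using init[of x] mult_pos_pos[OF that h_pos[of x]] by (simp add: p_def del: zero_less_mult_iff)
    qed (use h_fin \<open>t \<ge> 0\<close> in auto)
    then show ?thesis by (simp add: p_def)
  qed
  show ?thesis
  proof (rule field_le_epsilon)
    fix e :: real assume "e > 0"
    moreover have "exp ((c + 1) * t) * h x > 0"
      using h_pos by simp
    \<comment> \<open>This \<open>\<delta>\<close> makes the barrier at \<open>x\<close> and
      \<open>t\<close> equal to \<open>e\<close>.\<close>
    ultimately show "g x t \<le> 0 + e"
      using approx[of "e / (exp ((c + 1) * t) * h x)"]
      by (simp add: less_imp_neq[OF h_pos, symmetric])
  qed
qed

section \<open>Khasminskii's criterion and the conclusion\<close>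

theorem khasminskii:
  assumes "\<And>x. h x > 0" "\<And>r. finite {x. h x \<le> r}"
    and "\<And>x. laplacian w m h x \<le> c * h x" "c \<ge> 0"
  shows "stochastically_complete w m"
proof -
  have one: "heat_solution w m (\<lambda>_. 1) (\<lambda>_ _. 1)"
    by (auto simp: heat_solution_def)
  have "1 \<le> v x t" if v: "heat_solution w m (\<lambda>_. 1) v" and t: "t \<ge> 0" for v x t
  proof -
    have "1 - v x t \<le> 0"
    \<comment> \<open>The upper bound \<open>C = 1\<close> is the non-negativity of
      \<open>v\<close>.\<close>
    proof (rule bounded_solution_nonpos[where g = "\<lambda>x t. 1 - v x t" and C = 1, OF assms _ _ _ t])
      fix x s assume s: "0 \<le> (s::real)"
      have "((\<lambda>s. 1 - v x s) has_real_derivative - laplacian w m (\<lambda>y. v y s) x) (at s within {0..})"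
        using v s by (auto simp: heat_solution_def intro!: derivative_eq_intros)
      moreover have "laplacian w m (\<lambda>y. 1 - v y s) x = - laplacian w m (\<lambda>y. v y s) x"
        using laplacian_linear[of 1 "\<lambda>_. 1" "-1" "\<lambda>y. v y s" x] by simp
      ultimately show "((\<lambda>s. 1 - v x s) has_real_derivative laplacian w m (\<lambda>y. 1 - v y s) x)
          (at s within {0..})"
        by simp
    qed (use v in \<open>auto simp: heat_solution_def\<close>)
    then show ?thesis by simp
  qed
  with one have "smallest_heat_solution w m (\<lambda>_. 1) (\<lambda>_ _. 1)"
    by (auto simp: smallest_heat_solution_def)
  then show ?thesis
    by (simp add: stochastically_complete_def heat_semigroup_eq)
qed

end

theorem lemma3p6:
  fixes w :: "'a::countable \<Rightarrow> 'a \<Rightarrow> real" and m :: "'a \<Rightarrow> real" and K :: real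
  assumes "weighted_graph w m"
    and "Ric_ge w m K"
  shows "stochastically_complete w m"
proof -
  interpret weighted_graph w m by fact
  fix x\<^sub>0 :: 'a
  \<comment> \<open>\<open>Deg\<close> at the base vertex absorbs the constant term of the
    comparison and \<open>\<bar>K\<bar>\<close> the linear one, whatever the sign of
    \<open>K\<close>; both are non-negative, hence so is \<open>c\<close>.\<close>
  define c where "c = Deg w m x\<^sub>0 + \<bar>K\<bar>"
  show ?thesis
  proof (rule khasminskii[where h = "\<lambda>x. real (gdist w x\<^sub>0 x) + 1" and c = c])
    fix r
    show "finite {x. real (gdist w x\<^sub>0 x) + 1 \<le> r}"
      by (rule finite_subset[OF _ finite_gdist_ball[of x\<^sub>0 "nat \<lceil>r\<rceil>"]]) (auto, linarith)
  next
    fix x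
    have "laplacian w m (\<lambda>x. real (gdist w x\<^sub>0 x) + 1) x \<le> Deg w m x\<^sub>0 - K * gdist w x\<^sub>0 x"
      using laplacian_comparison[OF assms(2), of x\<^sub>0 x]
      by (subst laplacian_cong[where g = "\<lambda>x. real (gdist w x\<^sub>0 x)"]) auto
    also have "\<dots> \<le> Deg w m x\<^sub>0 + \<bar>K\<bar> * gdist w x\<^sub>0 x"
      using mult_right_mono[of "- K" "\<bar>K\<bar>" "real (gdist w x\<^sub>0 x)"] by simp
    also have "\<dots> \<le> c * (real (gdist w x\<^sub>0 x) + 1)"
      using Deg_nonneg[of x\<^sub>0] by (simp add: c_def algebra_simps)
    finally show "laplacian w m (\<lambda>x. real (gdist w x\<^sub>0 x) + 1) x \<le> c * (real (gdist w x\<^sub>0 x) + 1)" .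
  qed (use Deg_nonneg[of x\<^sub>0] in \<open>auto simp: c_def add_pos_nonneg\<close>)
qed

end
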